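(* Let $d$ be a $\mathbb{D}$-generic real over $V$. Then there is an unbounded real $x\in\omega^\omega\cap V[d]$ such that for every dominating real $y\in\omega^\omega\cap V[d]$ we have $x\leq^* y$.
   Context: For $x,y\in\omega^\omega$, $x\leq^* y$ means $x(n)\leq y(n)$ for all but finitely many $n$. In a generic extension, $y$ is dominating if $f\leq^* y$ for every ground-model $f\in V\cap\omega^\omega$, and $x$ is unbounded if $x\not\leq^* f$ for every $f\in V\cap\omega^\omega$. (Original) Hechler forcing $\mathbb{D}$: conditions are pairs $\langle s,f\rangle$ with $s\in\omega^{<\omega}$, $f\in\omega^\omega$, ordered by $\langle s',f'\rangle\leq\langle s,f\rangle$ iff $s\subseteq s'$, $f(n)\leq f'(n)$ for all $n$, and $f(n)\leq s'(n)$ for all $n\in|s'|\setminus|s|$. The generic real is the union of the first coordinates of conditions in the generic filter. *)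

theory Defs
  imports "HOL-Library.Sublist"
begin

section \<open>Hechler forcing\<close>

datatype cond = Cond (stem: "nat list") (side: "nat \<Rightarrow> nat")

definition stronger :: "cond \<Rightarrow> cond \<Rightarrow> bool" (infix "\<preceq>" 50) where
  "p \<preceq> q \<longleftrightarrow> prefix (stem q) (stem p) \<and> (\<forall>n. side q n \<le> side p n) \<and>
     (\<forall>n. length (stem q) \<le> n \<and> n < length (stem p) \<longrightarrow> side q n \<le> stem p ! n)"


section \<open>The forcing language and the forcing relation\<close>

text \<open>
  The ground model \<open>V\<close> is the universe of HOL. As no filter meets all dense sets of the universe,
  ``let \<open>G\<close> be \<open>\<D>\<close>-generic over \<open>V\<close>; then \<open>V[G]\<close> satisfies \<open>\<phi>\<close>'' has its usual meaning: every
  condition forces \<open>\<phi>\<close>.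

  A name is an arbitrary set of triples \<open>(n, m, r)\<close>, read as pairs of the check name of \<open>(n, m)\<close>
  and the condition \<open>r\<close>. Every subset of \<open>\<omega> \<times> \<omega>\<close> in the generic extension, in particular every
  real, is the value of such a (nice) name.
\<close>

type_synonym name = "(nat \<times> nat \<times> cond) set"

text \<open>
  \<open>Ground P\<close> is a statement about objects of \<open>V\<close>, and \<open>In_G r\<close> says that \<open>r\<close> belongs to the generic
  filter. The quantifiers range over \<open>\<omega>\<close> (the same in \<open>V\<close> and in the extension), over
  \<open>V \<inter> \<omega>\<^sup>\<omega>\<close>, over \<open>\<D>\<close> (as an element of \<open>V\<close>), and over the subsets of \<open>\<omega> \<times> \<omega>\<close> in the extension,
  the latter via their names.
\<close>

datatype sentence =
    Ground bool
  | In_G cond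
  | Neg sentence
  | Conj sentence sentence
  | All_nat "nat \<Rightarrow> sentence"
  | All_V "(nat \<Rightarrow> nat) \<Rightarrow> sentence"
  | All_cond "cond \<Rightarrow> sentence"
  | All_name "name \<Rightarrow> sentence"

primrec forces :: "cond \<Rightarrow> sentence \<Rightarrow> bool" (infix "\<tturnstile>" 50) where
  "p \<tturnstile> Ground P \<longleftrightarrow> P"
| "p \<tturnstile> In_G r \<longleftrightarrow> (\<forall>q. q \<preceq> p \<longrightarrow> (\<exists>q'. q' \<preceq> q \<and> q' \<preceq> r))"
| "p \<tturnstile> Neg \<phi> \<longleftrightarrow> (\<forall>q. q \<preceq> p \<longrightarrow> \<not> q \<tturnstile> \<phi>)"
| "p \<tturnstile> Conj \<phi> \<psi> \<longleftrightarrow> p \<tturnstile> \<phi> \<and> p \<tturnstile> \<psi>"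
| "p \<tturnstile> All_nat F \<longleftrightarrow> (\<forall>n. p \<tturnstile> F n)"
| "p \<tturnstile> All_V F \<longleftrightarrow> (\<forall>f. p \<tturnstile> F f)"
| "p \<tturnstile> All_cond F \<longleftrightarrow> (\<forall>r. p \<tturnstile> F r)"
| "p \<tturnstile> All_name F \<longleftrightarrow> (\<forall>\<tau>. p \<tturnstile> F \<tau>)"

definition true_in_extension :: "sentence \<Rightarrow> bool" where
  "true_in_extension \<phi> \<longleftrightarrow> (\<forall>p. p \<tturnstile> \<phi>)"

definition Imp :: "sentence \<Rightarrow> sentence \<Rightarrow> sentence" where
  "Imp \<phi> \<psi> = Neg (Conj \<phi> (Neg \<psi>))"

definition Ex_nat :: "(nat \<Rightarrow> sentence) \<Rightarrow> sentence" where
  "Ex_nat F = Neg (All_nat (\<lambda>n. Neg (F n)))"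

definition Ex_cond :: "(cond \<Rightarrow> sentence) \<Rightarrow> sentence" where
  "Ex_cond F = Neg (All_cond (\<lambda>r. Neg (F r)))"

definition Ex_name :: "(name \<Rightarrow> sentence) \<Rightarrow> sentence" where
  "Ex_name F = Neg (All_name (\<lambda>\<tau>. Neg (F \<tau>)))"


section \<open>The generic real and the reals of its extension\<close>

text \<open>\<open>d(i) = k\<close>, where \<open>d\<close> is the union of the first coordinates of the generic filter.\<close>

definition generic_real :: "nat \<Rightarrow> nat \<Rightarrow> sentence" where
  "generic_real i k =
     Ex_cond (\<lambda>r. Conj (In_G r) (Ground (i < length (stem r) \<and> stem r ! i = k)))"

text \<open>
  \<open>r \<in> G\<^sub>d\<close>, where \<open>G\<^sub>d\<close> is the set of all \<open>\<langle>s, f\<rangle>\<close> with \<open>s \<subset> d\<close> and \<open>f(i) \<le> d(i)\<close> for \<open>i \<ge> |s|\<close>.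
  This recovers the generic filter from \<open>d\<close> (lemma \<open>forces_in_filter_of_real\<close>), so \<open>V[d]\<close> consists
  of the values of names under \<open>G\<^sub>d\<close>.
\<close>

definition in_filter_of_real :: "cond \<Rightarrow> sentence" where
  "in_filter_of_real r =
     Conj (All_nat (\<lambda>i. Imp (Ground (i < length (stem r))) (generic_real i (stem r ! i))))
          (All_nat (\<lambda>i. Imp (Ground (length (stem r) \<le> i))
             (Ex_nat (\<lambda>k. Conj (generic_real i k) (Ground (side r i \<le> k))))))"

text \<open>\<open>(n, m)\<close> belongs to the value of \<open>\<tau>\<close> in \<open>V[d]\<close>; for a real this says \<open>\<tau>(n) = m\<close>.\<close>

definition val :: "name \<Rightarrow> nat \<Rightarrow> nat \<Rightarrow> sentence" where
  "val \<tau> n m = Ex_cond (\<lambda>r. Conj (Ground ((n, m, r) \<in> \<tau>)) (in_filter_of_real r))"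

definition check :: "(nat \<Rightarrow> nat) \<Rightarrow> name" where
  "check f = {(n, m, r). m = f n}"

definition is_real :: "name \<Rightarrow> sentence" where
  "is_real \<tau> =
     Conj (All_nat (\<lambda>n. Ex_nat (\<lambda>m. val \<tau> n m)))
          (All_nat (\<lambda>n. All_nat (\<lambda>m. All_nat (\<lambda>m'.
             Imp (Conj (val \<tau> n m) (val \<tau> n m')) (Ground (m = m'))))))"

definition le_at :: "name \<Rightarrow> name \<Rightarrow> nat \<Rightarrow> sentence" where
  "le_at \<sigma> \<tau> n =
     Ex_nat (\<lambda>k. Ex_nat (\<lambda>l. Conj (Conj (val \<sigma> n k) (val \<tau> n l)) (Ground (k \<le> l))))"

definition le_star :: "name \<Rightarrow> name \<Rightarrow> sentence" where
  "le_star \<sigma> \<tau> = Ex_nat (\<lambda>N. All_nat (\<lambda>n. Imp (Ground (N \<le> n)) (le_at \<sigma> \<tau> n)))"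

definition dominating :: "name \<Rightarrow> sentence" where
  "dominating \<tau> = All_V (\<lambda>f. le_star (check f) \<tau>)"

definition unbounded :: "name \<Rightarrow> sentence" where
  "unbounded \<tau> = All_V (\<lambda>f. Neg (le_star \<tau> (check f)))"


section \<open>Basic facts\<close>

lemma stronger_refl [simp]: "p \<preceq> p"
  by (auto simp: stronger_def)

lemma stronger_trans: "p \<preceq> r" if "p \<preceq> q" "q \<preceq> r"
proof -
  have "side r n \<le> stem p ! n" if n: "length (stem r) \<le> n" "n < length (stem p)" for n
  proof (cases "n < length (stem q)")
    case True
    then have "stem p ! n = stem q ! n"
      using \<open>p \<preceq> q\<close> by (auto simp: stronger_def prefix_def nth_append)
    then show ?thesis
      using True n \<open>q \<preceq> r\<close> by (auto simp: stronger_def)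
  next
    case False
    then have "side q n \<le> stem p ! n"
      using n \<open>p \<preceq> q\<close> by (auto simp: stronger_def)
    then show ?thesis
      using \<open>q \<preceq> r\<close> le_trans[of "side r n" "side q n"] by (simp add: stronger_def)
  qed
  moreover have "prefix (stem r) (stem p)"
    using that by (auto simp: stronger_def intro: prefix_order.trans)
  moreover have "side r n \<le> side p n" for n
    using that le_trans[of "side r n" "side q n" "side p n"] by (simp add: stronger_def)
  ultimately show ?thesis
    by (simp add: stronger_def)
qed

lemma forces_mono: "p \<tturnstile> \<phi> \<Longrightarrow> q \<preceq> p \<Longrightarrow> q \<tturnstile> \<phi>"
proof (induction \<phi> arbitrary: p q)
  case (In_G c)
  then show ?case using stronger_trans unfolding forces.simps by blast
next
  case (Neg \<phi>)
  then show ?case using stronger_trans unfolding forces.simps by blast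
qed (simp_all, blast+)

lemma forces_if_dense: "(\<And>q. q \<preceq> p \<Longrightarrow> \<exists>r. r \<preceq> q \<and> r \<tturnstile> \<phi>) \<Longrightarrow> p \<tturnstile> \<phi>"
proof (induction \<phi> arbitrary: p)
  case (In_G c)
  show ?case
    unfolding forces.simps
  proof (intro allI impI)
    fix q assume "q \<preceq> p"
    then obtain r where "r \<preceq> q" "r \<tturnstile> In_G c" using In_G by blast
    then obtain r' where "r' \<preceq> r" "r' \<preceq> c" using stronger_refl[of r] unfolding forces.simps by blast
    then show "\<exists>q'. q' \<preceq> q \<and> q' \<preceq> c"
      using \<open>r \<preceq> q\<close> stronger_trans by blast
  qed
next
  case (Neg \<phi>)
  show ?case
    unfolding forces.simps
  proof (intro allI impI notI)
    fix q assume "q \<preceq> p" "q \<tturnstile> \<phi>"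
    then obtain r where "r \<preceq> q" "r \<tturnstile> Neg \<phi>" using Neg.prems by blast
    then show False
      using forces_mono[OF \<open>q \<tturnstile> \<phi>\<close>] stronger_refl[of r] unfolding forces.simps by blast
  qed
next
  case (Ground P)
  show ?case using Ground[OF stronger_refl] by simp
qed (simp_all, blast+)

lemma forces_Imp: "p \<tturnstile> Imp \<phi> \<psi> \<longleftrightarrow> (\<forall>q. q \<preceq> p \<longrightarrow> q \<tturnstile> \<phi> \<longrightarrow> q \<tturnstile> \<psi>)"
proof
  assume *: "p \<tturnstile> Imp \<phi> \<psi>"
  show "\<forall>q. q \<preceq> p \<longrightarrow> q \<tturnstile> \<phi> \<longrightarrow> q \<tturnstile> \<psi>"
  proof (intro allI impI)
    fix q assume "q \<preceq> p" "q \<tturnstile> \<phi>"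
    show "q \<tturnstile> \<psi>"
    proof (rule forces_if_dense)
      fix r assume "r \<preceq> q"
      then have "r \<preceq> p" "r \<tturnstile> \<phi>"
        using \<open>q \<preceq> p\<close> \<open>q \<tturnstile> \<phi>\<close> stronger_trans forces_mono by blast+
      then show "\<exists>r'. r' \<preceq> r \<and> r' \<tturnstile> \<psi>" using * by (auto simp: Imp_def)
    qed
  qed
next
  assume "\<forall>q. q \<preceq> p \<longrightarrow> q \<tturnstile> \<phi> \<longrightarrow> q \<tturnstile> \<psi>"
  then show "p \<tturnstile> Imp \<phi> \<psi>"
    unfolding Imp_def forces.simps using stronger_refl by blast
qed

lemma forces_Ex:
  "p \<tturnstile> Ex_nat F \<longleftrightarrow> (\<forall>q. q \<preceq> p \<longrightarrow> (\<exists>r n. r \<preceq> q \<and> r \<tturnstile> F n))"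
  "p \<tturnstile> Ex_cond F' \<longleftrightarrow> (\<forall>q. q \<preceq> p \<longrightarrow> (\<exists>r c. r \<preceq> q \<and> r \<tturnstile> F' c))"
  "p \<tturnstile> Ex_name F'' \<longleftrightarrow> (\<forall>q. q \<preceq> p \<longrightarrow> (\<exists>r \<tau>. r \<preceq> q \<and> r \<tturnstile> F'' \<tau>))"
  unfolding Ex_nat_def Ex_cond_def Ex_name_def forces.simps by blast+

lemma extend_stem:
  assumes "side p (length (stem p)) \<le> k"
  shows "Cond (stem p @ [k]) (side p) \<preceq> p"
  using assms by (auto simp: stronger_def nth_append less_Suc_eq)

lemma extend_stem_beyond:
  "\<exists>q. q \<preceq> p \<and> N < length (stem q)"
proof (induction N)
  case 0
  show ?case
    using extend_stem[of p "side p (length (stem p))"]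
    by (intro exI[of _ "Cond (stem p @ [side p (length (stem p))]) (side p)"]) simp
next
  case (Suc N)
  then obtain q where q: "q \<preceq> p" "N < length (stem q)" by blast
  let ?q = "Cond (stem q @ [side q (length (stem q))]) (side q)"
  have "?q \<preceq> q" by (rule extend_stem) simp
  with q have "?q \<preceq> p" "Suc N < length (stem ?q)" using stronger_trans[OF _ q(1)] by auto
  then show ?case by blast
qed

lemma stem_nth: "stem q ! i = stem p ! i" "i < length (stem q)" if "q \<preceq> p" "i < length (stem p)"
  using that by (auto simp: stronger_def prefix_def nth_append)

lemma forces_generic_real:
  "p \<tturnstile> generic_real i k \<longleftrightarrow> i < length (stem p) \<and> stem p ! i = k"
proof
  assume *: "p \<tturnstile> generic_real i k"
  have decided: "stem q ! i = k" if q: "q \<preceq> p" "i < length (stem q)" for q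
  proof -
    obtain r c where r: "r \<preceq> q" "r \<tturnstile> In_G c" "i < length (stem c)" "stem c ! i = k"
      using * q unfolding generic_real_def forces_Ex by auto
    then obtain q' where "q' \<preceq> r" "q' \<preceq> c" using stronger_refl[of r] unfolding forces.simps by blast
    then show ?thesis
      using stem_nth(1)[OF \<open>q' \<preceq> c\<close>, of i] stem_nth(1)[OF stronger_trans[OF \<open>q' \<preceq> r\<close> \<open>r \<preceq> q\<close>], of i]
        r q by simp
  qed
  have "i < length (stem p)"
  proof (rule ccontr)
    assume "\<not> i < length (stem p)"
    then have "length (stem p) \<le> i" by simp
    then have "\<exists>q. q \<preceq> p \<and> length (stem q) = i"
    proof (induction i rule: dec_induct)
      case base
      show ?case using stronger_refl by blast
    next
      case (step n)
      then obtain q where q: "q \<preceq> p" "length (stem q) = n" by blast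
      let ?q = "Cond (stem q @ [side q n]) (side q)"
      have "?q \<preceq> q" using q by (intro extend_stem) simp
      then have "?q \<preceq> p" using q stronger_trans by blast
      then show ?case using q by (intro exI[of _ ?q]) simp
    qed
    then obtain q where q: "q \<preceq> p" "length (stem q) = i" by blast
    let ?k = "Suc (k + side q i)"
    have "Cond (stem q @ [?k]) (side q) \<preceq> q" using q by (intro extend_stem) auto
    then have "Cond (stem q @ [?k]) (side q) \<preceq> p" using q stronger_trans by blast
    from decided[OF this] q show False by auto
  qed
  then show "i < length (stem p) \<and> stem p ! i = k" using decided by simp
next
  assume *: "i < length (stem p) \<and> stem p ! i = k"
  show "p \<tturnstile> generic_real i k"
    unfolding generic_real_def forces_Ex
  proof (intro allI impI)
    fix q assume "q \<preceq> p"
    then have "q \<tturnstile> Conj (In_G p) (Ground (i < length (stem p) \<and> stem p ! i = k))"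
      using * stronger_trans[OF _ \<open>q \<preceq> p\<close>] stronger_refl unfolding forces.simps by blast
    then show "\<exists>r c. r \<preceq> q \<and> r \<tturnstile> Conj (In_G c) (Ground (i < length (stem c) \<and> stem c ! i = k))"
      using stronger_refl by blast
  qed
qed

lemma generic_real_total: "p \<tturnstile> Ex_nat (generic_real i)"
  unfolding forces_Ex forces_generic_real using extend_stem_beyond by blast

lemma forces_in_filter_of_real: "p \<tturnstile> in_filter_of_real r \<longleftrightarrow> p \<tturnstile> In_G r"
proof
  assume *: "p \<tturnstile> in_filter_of_real r"
  show "p \<tturnstile> In_G r"
    unfolding forces.simps
  proof (intro allI impI)
    fix q assume q: "q \<preceq> p"
    have stem: "i < length (stem p) \<and> stem p ! i = stem r ! i" if "i < length (stem r)" for i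
      using * that unfolding in_filter_of_real_def
      by (auto simp: forces_Imp forces_generic_real)
    have pre: "prefix (stem r) (stem p)"
    proof -
      have "length (stem r) \<le> length (stem p)" using stem by (meson leI less_irrefl)
      then have "take (length (stem r)) (stem p) = stem r"
        using stem by (intro nth_equalityI) auto
      then show ?thesis by (metis take_is_prefix)
    qed
    have above: "side r i \<le> stem q ! i" if i: "length (stem r) \<le> i" "i < length (stem q)" for i
    proof -
      have "p \<tturnstile> Ex_nat (\<lambda>k. Conj (generic_real i k) (Ground (side r i \<le> k)))"
        using * i stronger_refl unfolding in_filter_of_real_def by (auto simp: forces_Imp)
      then obtain q' k where "q' \<preceq> q" "q' \<tturnstile> generic_real i k" "side r i \<le> k"
        using q unfolding forces_Ex by auto
      then show ?thesis using i by (auto simp: forces_generic_real stem_nth)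
    qed
    let ?q = "Cond (stem q) (\<lambda>i. max (side q i) (side r i))"
    have "?q \<preceq> q" by (auto simp: stronger_def)
    moreover have "?q \<preceq> r"
      using pre q above by (auto simp: stronger_def)
    ultimately show "\<exists>q'. q' \<preceq> q \<and> q' \<preceq> r" by blast
  qed
next
  assume *: "p \<tturnstile> In_G r"
  show "p \<tturnstile> in_filter_of_real r"
  proof (rule forces_if_dense)
    fix q assume "q \<preceq> p"
    then obtain q' where q': "q' \<preceq> q" "q' \<preceq> r" using * by auto
    have "c \<tturnstile> Ex_nat (\<lambda>k. Conj (generic_real i k) (Ground (side r i \<le> k)))"
      if c: "c \<preceq> r" "length (stem r) \<le> i" for c i
      unfolding forces_Ex
    proof (intro allI impI)
      fix e assume "e \<preceq> c"
      obtain e' where e': "e' \<preceq> e" "i < length (stem e')" using extend_stem_beyond by blast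
      then have "e' \<preceq> r" using \<open>e \<preceq> c\<close> c stronger_trans by blast
      then have "e' \<tturnstile> Conj (generic_real i (stem e' ! i)) (Ground (side r i \<le> stem e' ! i))"
        using e' c by (auto simp: forces_generic_real stronger_def)
      then show "\<exists>r' n. r' \<preceq> e \<and> r' \<tturnstile> Conj (generic_real i n) (Ground (side r i \<le> n))"
        using e' by blast
    qed
    moreover have "c \<tturnstile> generic_real i (stem r ! i)" if "c \<preceq> r" "i < length (stem r)" for c i
      using stem_nth[OF that] by (simp add: forces_generic_real)
    ultimately have "q' \<tturnstile> in_filter_of_real r"
      using stronger_trans[OF _ q'(2)] by (simp add: in_filter_of_real_def forces_Imp)
    with q' show "\<exists>r'. r' \<preceq> q \<and> r' \<tturnstile> in_filter_of_real r" by blast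
  qed
qed

lemma forces_check: "p \<tturnstile> val (check f) n m \<longleftrightarrow> m = f n"
proof
  assume "p \<tturnstile> val (check f) n m"
  then show "m = f n"
    unfolding val_def forces_Ex by (auto simp: check_def dest: spec[of _ p])
next
  assume "m = f n"
  then have "q \<tturnstile> Conj (Ground ((n, m, q) \<in> check f)) (in_filter_of_real q)" for q
    unfolding check_def forces.simps forces_in_filter_of_real using stronger_refl by blast
  then show "p \<tturnstile> val (check f) n m"
    unfolding val_def forces_Ex using stronger_refl by blast
qed

end

theory Submission
  imports Defs
begin

text \<open>
  The witness is \<open>x(n) = j\<close>, where \<open>k\<close> is the first index with \<open>d(k) > n\<close> and \<open>j\<close> is the last
  index at which \<open>d\<close> attains its minimum over \<open>[k, \<infinity>)\<close>. A condition may continue its stem by a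
  long constant block, so \<open>x\<close> is unbounded.

  Let \<open>y\<close> be dominating. There are finitely many stems \<open>u\<close> with length and entries at most \<open>n\<close>,
  so some \<open>h \<in> V\<close> satisfies: if \<open>m\<close> is least such that no \<open>\<langle>u, g\<rangle>\<close> forces \<open>m \<le> y(n)\<close>, then
  \<open>m \<le> h(n)\<close>. If \<open>\<langle>t, g\<rangle>\<close> forces \<open>h(n) \<le> y(n)\<close> for \<open>n \<ge> N\<close>, then for such \<open>n\<close> and every such
  \<open>u\<close> below \<open>\<langle>t, g\<rangle>\<close> no \<open>m\<close> as above exists: for every \<open>m\<close> some \<open>\<langle>u, w\<^sub>u\<^sub>n\<^sub>m\<rangle>\<close> forces \<open>m \<le> y(n)\<close>.
  Diagonalise the \<open>w\<^sub>u\<^sub>n\<^sub>m\<close> into one side \<open>G\<close>. If \<open>d\<close> passes through \<open>\<langle>t, G\<rangle>\<close> and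
  \<open>x(n) = j \<ge> n\<close>, then \<open>d(i) \<ge> d(j) \<ge> G(j)\<close> for \<open>k \<le> i \<le> j\<close>, so \<open>d\<close> passes through
  \<open>\<langle>d|k, w\<rangle>\<close> for the \<open>w\<close> belonging to \<open>d|k\<close>, \<open>n\<close> and \<open>j\<close>, and \<open>j \<le> y(n)\<close>. If
  \<open>j < n\<close>, then \<open>j \<le> y(n)\<close> since \<open>y\<close> dominates the identity.
\<close>

section \<open>Conditions that decide a value of the witness\<close>

text \<open>The last conjunct keeps all values of \<open>d\<close> beyond the stem above
  \<open>d(j)\<close>, so the stem alone fixes \<open>j\<close> as the last minimum.\<close>

definition decides_from :: "nat \<Rightarrow> cond \<Rightarrow> nat \<Rightarrow> nat \<Rightarrow> bool" where
  "decides_from k p n j \<longleftrightarrow> k \<le> j \<and> j < length (stem p) \<and> n < stem p ! k \<and>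
     (\<forall>i<k. stem p ! i \<le> n) \<and>
     (\<forall>i. k \<le> i \<and> i \<le> j \<longrightarrow> stem p ! j \<le> stem p ! i) \<and>
     (\<forall>i. j < i \<and> i < length (stem p) \<longrightarrow> stem p ! j < stem p ! i) \<and>
     (\<forall>i\<ge>length (stem p). stem p ! j < side p i)"

definition decides :: "cond \<Rightarrow> nat \<Rightarrow> nat \<Rightarrow> bool" where
  "decides p n j \<longleftrightarrow> (\<exists>k. decides_from k p n j)"

definition last_min :: name where
  "last_min = {(n, j, r). decides r n j}"

lemma stronger_length_le: "q \<preceq> p \<Longrightarrow> length (stem p) \<le> length (stem q)"
  by (auto simp: stronger_def prefix_length_le)

lemma side_le_stem_nth:
  "q \<preceq> p \<Longrightarrow> length (stem p) \<le> i \<Longrightarrow> i < length (stem q) \<Longrightarrow> side p i \<le> stem q ! i"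
  by (simp add: stronger_def)

text \<open>Old entries are kept; new entries and new sides are at least the old side, hence above
  the minimum \<open>stem p ! j\<close>.\<close>

lemma decides_mono:
  assumes "decides p n j" "q \<preceq> p"
  shows "decides q n j"
proof -
  obtain k where "decides_from k p n j"
    using assms(1) unfolding decides_def by blast
  then have k: "k \<le> j" "j < length (stem p)" "n < stem p ! k" "\<And>i. i < k \<Longrightarrow> stem p ! i \<le> n"
    "\<And>i. k \<le> i \<Longrightarrow> i \<le> j \<Longrightarrow> stem p ! j \<le> stem p ! i"
    "\<And>i. j < i \<Longrightarrow> i < length (stem p) \<Longrightarrow> stem p ! j < stem p ! i"
    "\<And>i. length (stem p) \<le> i \<Longrightarrow> stem p ! j < side p i"
    by (simp_all add: decides_from_def)
  have eq: "stem q ! i = stem p ! i" if "i < length (stem p)" for i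
    using stem_nth(1)[OF assms(2) that] .
  have len: "length (stem p) \<le> length (stem q)"
    using assms(2) by (rule stronger_length_le)
  have later: "stem p ! j < stem q ! i" if "j < i" "i < length (stem q)" for i
  proof (cases "i < length (stem p)")
    case True
    then show ?thesis using k that eq by simp
  next
    case False
    then show ?thesis
      using k(7) side_le_stem_nth[OF assms(2), of i] that by (meson leI less_le_trans)
  qed
  have tail: "stem p ! j < side q i" if "length (stem q) \<le> i" for i
    using k(7) that len assms(2) unfolding stronger_def by (meson le_trans less_le_trans)
  show ?thesis
    unfolding decides_def decides_from_def
    using k len eq later tail by (intro exI[of _ k]) simp
qed

text \<open>The first index with an entry above \<open>n\<close> is unique, and two last minima past
  it would each have to be the later one.\<close>

lemma decides_unique:
  assumes "decides p n j" "decides p n j'"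
  shows "j = j'"
proof -
  have same: "\<not> j < j'" if both: "decides p n j" "decides p n j'" for j j'
  proof
    assume "j < j'"
    obtain k k' where "decides_from k p n j" and from': "decides_from k' p n j'"
      using both unfolding decides_def by blast
    then have k: "k \<le> j" "n < stem p ! k" "\<And>i. i < k \<Longrightarrow> stem p ! i \<le> n"
      "\<And>i. j < i \<Longrightarrow> i < length (stem p) \<Longrightarrow> stem p ! j < stem p ! i"
      by (simp_all add: decides_from_def)
    have k': "j' < length (stem p)" "n < stem p ! k'"
      "\<And>i. i < k' \<Longrightarrow> stem p ! i \<le> n"
      "\<And>i. k' \<le> i \<Longrightarrow> i \<le> j' \<Longrightarrow> stem p ! j' \<le> stem p ! i"
      using from' by (simp_all add: decides_from_def)
    have "\<not> k' < k" "\<not> k < k'"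
      using k(2) k(3)[of k'] k'(2) k'(3)[of k] by auto
    then have "k' \<le> j" using k(1) by simp
    then have "stem p ! j' \<le> stem p ! j"
      using k'(4) \<open>j < j'\<close> by simp
    moreover have "stem p ! j < stem p ! j'"
      using k(4) k'(1) \<open>j < j'\<close> by simp
    ultimately show False by simp
  qed
  show ?thesis
    using same assms by (meson linorder_neqE_nat)
qed

lemma last_minimum_exists:
  fixes f :: "nat \<Rightarrow> nat"
  assumes "k < L"
  obtains j where "k \<le> j" "j < L" "\<And>i. k \<le> i \<Longrightarrow> i < L \<Longrightarrow> f j \<le> f i"
    "\<And>i. j < i \<Longrightarrow> i < L \<Longrightarrow> f j < f i"
proof -
  define M where "M = Min (f ` {k..<L})"
  define A where "A = {i \<in> {k..<L}. f i = M}"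
  have M: "M \<in> f ` {k..<L}"
    unfolding M_def using assms by (intro Min_in) auto
  have least: "M \<le> f i" if "k \<le> i" "i < L" for i
    unfolding M_def using that by (intro Min_le) auto
  have "finite A" "A \<noteq> {}"
    unfolding A_def using M by auto
  then have j: "Max A \<in> A" "\<And>i. i \<in> A \<Longrightarrow> i \<le> Max A"
    by simp_all
  show ?thesis
  proof (rule that[of "Max A"])
    show "f (Max A) < f i" if "Max A < i" "i < L" for i
    proof -
      have "k \<le> i" using j(1) that by (simp add: A_def)
      moreover have "i \<notin> A" using j(2)[of i] that by auto
      ultimately show ?thesis using least[of i] j(1) that by (auto simp: A_def)
    qed
  qed (use j(1) least in \<open>auto simp: A_def\<close>)
qed

lemma decides_dense: "\<exists>q j. q \<preceq> p \<and> decides q n j"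
proof -
  \<comment> \<open>The new entry exceeds \<open>n\<close>, so some first index \<open>k\<close> has
    an entry above \<open>n\<close>.\<close>
  define s where "s = stem p @ [Suc n + side p (length (stem p))]"
  \<comment> \<open>The new side exceeds every entry of \<open>s\<close>, so the minimum found in
    \<open>s\<close> is final.\<close>
  define f where "f i = side p i + Suc (sum_list s)" for i
  have q: "Cond s f \<preceq> p"
    by (auto simp: stronger_def s_def f_def nth_append less_Suc_eq)
  define k where "k = (LEAST k. n < s ! k)"
  have "n < s ! length (stem p)" by (simp add: s_def nth_append)
  then have k: "n < s ! k" "k \<le> length (stem p)"
    unfolding k_def by (rule LeastI, rule Least_le)
  have before: "s ! i \<le> n" if "i < k" for i
    using not_less_Least[of i "\<lambda>k. n < s ! k"] that unfolding k_def by simp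
  have "k < length s" using k by (simp add: s_def)
  then obtain j where j: "k \<le> j" "j < length s"
    "\<And>i. k \<le> i \<Longrightarrow> i < length s \<Longrightarrow> s ! j \<le> s ! i"
    "\<And>i. j < i \<Longrightarrow> i < length s \<Longrightarrow> s ! j < s ! i"
    using last_minimum_exists[of k "length s" "\<lambda>i. s ! i"] by blast
  have "s ! j \<le> sum_list s" using j(2) by (simp add: elem_le_sum_list)
  then have "s ! j < f i" for i by (simp add: f_def)
  then have "decides (Cond s f) n j"
    unfolding decides_def decides_from_def using k before j by (intro exI[of _ k]) simp
  with q show ?thesis by blast
qed

lemma decides_beyond:
  "\<exists>q n j. q \<preceq> p \<and> N \<le> n \<and> b n < j \<and> decides q n j"
proof -
  define k where "k = length (stem p)"
  \<comment> \<open>\<open>n\<close> bounds all entries of the stem, so the first entry above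
    \<open>n\<close> is at \<open>k\<close>, where the constant block starts.\<close>
  define n where "n = N + sum_list (stem p)"
  define j where "j = Suc (k + b n)"
  \<comment> \<open>\<open>A\<close> exceeds \<open>n\<close> and respects the side up to
    \<open>j\<close>; a side above \<open>A\<close> then makes the end \<open>j\<close> of the block
    the last minimum.\<close>
  define A where "A = Suc n + (\<Sum>i\<le>j. side p i)"
  define s where "s = stem p @ replicate (Suc j - k) A"
  have len: "length s = Suc j" by (simp add: s_def k_def j_def)
  have s1: "s ! i = stem p ! i" if "i < k" for i
    using that by (simp add: s_def k_def nth_append)
  have s2: "s ! i = A" if "k \<le> i" "i \<le> j" for i
    using that by (simp add: s_def k_def nth_append)
  have small: "stem p ! i \<le> n" if "i < k" for i
    using elem_le_sum_list[of i "stem p"] that by (simp add: n_def k_def)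
  have "side p i \<le> A" if "i \<le> j" for i
    using member_le_sum[of i "{..j}" "side p"] that by (simp add: A_def)
  then have "Cond s (\<lambda>i. side p i + Suc A) \<preceq> p"
    using s2 len by (auto simp: stronger_def k_def s_def)
  moreover have "decides (Cond s (\<lambda>i. side p i + Suc A)) n j"
    unfolding decides_def decides_from_def using s1 s2 small len
    by (intro exI[of _ k]) (auto simp: j_def A_def)
  ultimately show ?thesis
    by (intro exI[of _ "Cond s (\<lambda>i. side p i + Suc A)"] exI[of _ n] exI[of _ j])
      (simp add: n_def j_def)
qed

section \<open>The witness as a real of the extension\<close>

text \<open>A deciding condition in the generic filter passes its decision to common extensions;
  conversely, each condition forces itself into the filter.\<close>

lemma forces_val_last_min:
  "p \<tturnstile> val last_min n j \<longleftrightarrow> (\<forall>q. q \<preceq> p \<longrightarrow> (\<exists>r. r \<preceq> q \<and> decides r n j))"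
proof
  assume *: "p \<tturnstile> val last_min n j"
  show "\<forall>q. q \<preceq> p \<longrightarrow> (\<exists>r. r \<preceq> q \<and> decides r n j)"
  proof (intro allI impI)
    fix q assume "q \<preceq> p"
    then obtain r c where "r \<preceq> q" "decides c n j" "r \<tturnstile> In_G c"
      using * unfolding val_def forces_Ex forces.simps forces_in_filter_of_real last_min_def
      by blast
    moreover from this obtain r' where "r' \<preceq> r" "r' \<preceq> c"
      using stronger_refl[of r] unfolding forces.simps by blast
    ultimately show "\<exists>r. r \<preceq> q \<and> decides r n j"
      using decides_mono stronger_trans by blast
  qed
next
  assume *: "\<forall>q. q \<preceq> p \<longrightarrow> (\<exists>r. r \<preceq> q \<and> decides r n j)"
  have "r \<tturnstile> In_G r" for r
    unfolding forces.simps using stronger_refl by blast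
  with * show "p \<tturnstile> val last_min n j"
    unfolding val_def forces_Ex forces.simps(1,4) forces_in_filter_of_real last_min_def
    by blast
qed

lemma decides_forces_val: "decides p n j \<Longrightarrow> p \<tturnstile> val last_min n j"
  unfolding forces_val_last_min using decides_mono stronger_refl by blast

lemma forces_is_real_last_min: "p \<tturnstile> is_real last_min"
proof -
  have "p \<tturnstile> Ex_nat (val last_min n)" for n
    unfolding forces_Ex using decides_dense decides_forces_val by blast
  moreover have "m = m'" if m: "q \<tturnstile> val last_min n m" "q \<tturnstile> val last_min n m'" for q n m m'
  proof -
    obtain r where r: "r \<preceq> q" "decides r n m"
      using m(1) stronger_refl unfolding forces_val_last_min by blast
    then obtain r' where "r' \<preceq> r" "decides r' n m'"
      using m(2) unfolding forces_val_last_min by blast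
    then show ?thesis using r decides_mono decides_unique by blast
  qed
  ultimately show ?thesis
    unfolding is_real_def forces.simps forces_Imp by blast
qed

section \<open>Unboundedness of the witness\<close>

lemma forces_le_at:
  "p \<tturnstile> le_at \<sigma> \<tau> n \<longleftrightarrow>
    (\<forall>q. q \<preceq> p \<longrightarrow> (\<exists>r k l. r \<preceq> q \<and> r \<tturnstile> val \<sigma> n k \<and> r \<tturnstile> val \<tau> n l \<and> k \<le> l))"
  (is "_ \<longleftrightarrow> ?R")
proof
  assume *: "p \<tturnstile> le_at \<sigma> \<tau> n"
  show ?R
  proof (intro allI impI)
    fix q assume "q \<preceq> p"
    then obtain r k where r: "r \<preceq> q"
      "r \<tturnstile> Ex_nat (\<lambda>l. Conj (Conj (val \<sigma> n k) (val \<tau> n l)) (Ground (k \<le> l)))"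
      using * unfolding le_at_def forces_Ex(1)[of p] by blast
    then obtain r' l where "r' \<preceq> r" "r' \<tturnstile> val \<sigma> n k" "r' \<tturnstile> val \<tau> n l" "k \<le> l"
      using stronger_refl[of r] unfolding forces_Ex forces.simps by blast
    then show "\<exists>r k l. r \<preceq> q \<and> r \<tturnstile> val \<sigma> n k \<and> r \<tturnstile> val \<tau> n l \<and> k \<le> l"
      using r(1) stronger_trans by blast
  qed
next
  assume *: ?R
  have ex: "r \<tturnstile> Ex_nat (\<lambda>l. Conj (Conj (val \<sigma> n k) (val \<tau> n l)) (Ground (k \<le> l)))"
    if "r \<tturnstile> val \<sigma> n k" "r \<tturnstile> val \<tau> n l" "k \<le> l" for r k l
    unfolding forces_Ex forces.simps using that forces_mono stronger_refl by blast
  show "p \<tturnstile> le_at \<sigma> \<tau> n"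
    unfolding le_at_def forces_Ex(1)[of p]
  proof (intro allI impI)
    fix q assume "q \<preceq> p"
    then obtain r k l where "r \<preceq> q" "r \<tturnstile> val \<sigma> n k" "r \<tturnstile> val \<tau> n l" "k \<le> l"
      using * by blast
    then show "\<exists>r k. r \<preceq> q \<and>
        r \<tturnstile> Ex_nat (\<lambda>l. Conj (Conj (val \<sigma> n k) (val \<tau> n l)) (Ground (k \<le> l)))"
      using ex by blast
  qed
qed

lemma forces_le_star:
  "p \<tturnstile> le_star \<sigma> \<tau> \<longleftrightarrow>
    (\<forall>q. q \<preceq> p \<longrightarrow> (\<exists>r N. r \<preceq> q \<and> (\<forall>n\<ge>N. r \<tturnstile> le_at \<sigma> \<tau> n)))"
  unfolding le_star_def forces_Ex forces_Imp forces.simps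
  using forces_mono stronger_refl by blast

text \<open>Below a condition forcing the bound \<open>b\<close> from \<open>N\<close> on,
  \<open>decides_beyond\<close> yields a decided value above \<open>b n\<close> for some
  \<open>n\<close> \<ge> \<open>N\<close>.\<close>

lemma forces_unbounded_last_min: "p \<tturnstile> unbounded last_min"
proof -
  have False if le: "q \<tturnstile> le_star last_min (check b)" for q b
  proof -
    obtain r N where r: "\<And>n. N \<le> n \<Longrightarrow> r \<tturnstile> le_at last_min (check b) n"
      using le stronger_refl unfolding forces_le_star by blast
    obtain r' n j where r': "r' \<preceq> r" "N \<le> n" "b n < j" "decides r' n j"
      using decides_beyond by blast
    obtain c k l where c: "c \<preceq> r'" "c \<tturnstile> val last_min n k" "c \<tturnstile> val (check b) n l" "k \<le> l"
      using r[OF r'(2)] r'(1) unfolding forces_le_at by blast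
    obtain c' where "c' \<preceq> c" "decides c' n k"
      using c(2) stronger_refl unfolding forces_val_last_min by blast
    then have "k = j"
      using c(1) r'(4) decides_mono decides_unique stronger_trans by blast
    then show False
      using c(3,4) r'(3) by (simp add: forces_check)
  qed
  then show ?thesis
    unfolding unbounded_def forces.simps by blast
qed

section \<open>Dominating reals lie above the witness\<close>

lemma forces_check_le_at:
  "p \<tturnstile> le_at (check b) \<tau> n \<longleftrightarrow>
    (\<forall>q. q \<preceq> p \<longrightarrow> (\<exists>r l. r \<preceq> q \<and> r \<tturnstile> val \<tau> n l \<and> b n \<le> l))"
  by (simp add: forces_le_at forces_check)

text \<open>Since the side is free, this is a property of the stem \<open>u\<close> alone.\<close>

definition can_force_ge :: "name \<Rightarrow> nat list \<Rightarrow> nat \<Rightarrow> nat \<Rightarrow> bool" where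
  "can_force_ge \<tau> u n m \<longleftrightarrow> (\<exists>w. Cond u w \<tturnstile> le_at (check (\<lambda>_. m)) \<tau> n)"

lemma forces_check_le_at_mono:
  "p \<tturnstile> le_at (check b) \<tau> n \<Longrightarrow> b' n \<le> b n \<Longrightarrow> p \<tturnstile> le_at (check b') \<tau> n"
  unfolding forces_check_le_at by (meson le_trans)

text \<open>If \<open>k\<close> is the first index with \<open>d(k) > n\<close> and \<open>k\<close>
  \<le> \<open>n\<close>, then \<open>d|k\<close> is among these.\<close>

definition small_stems :: "nat \<Rightarrow> nat list set" where
  "small_stems n = {u. set u \<subseteq> {..n} \<and> length u \<le> n}"

lemma finite_small_stems [simp]: "finite (small_stems n)"
  unfolding small_stems_def by (rule finite_lists_length_le) simp

lemma dominating_can_force_ge: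
  assumes "p \<tturnstile> dominating \<tau>"
  obtains q N where "q \<preceq> p" "\<And>n. N \<le> n \<Longrightarrow> q \<tturnstile> le_at (check (\<lambda>n. n)) \<tau> n"
    "\<And>n u m. N \<le> n \<Longrightarrow> u \<in> small_stems n \<Longrightarrow> Cond u (side q) \<preceq> q \<Longrightarrow> can_force_ge \<tau> u n m"
proof -
  \<comment> \<open>If all \<open>m\<close> can be forced, the \<open>LEAST\<close> is an arbitrary
    number, which only enlarges \<open>h\<close>. The summand \<open>n\<close> makes
    \<open>h\<close> bound the identity.\<close>
  define h where
    "h n = n + (\<Sum>u\<in>small_stems n. LEAST m. \<not> can_force_ge \<tau> u n m)" for n
  have "p \<tturnstile> le_star (check h) \<tau>"
    using assms by (simp add: dominating_def)
  then obtain q N where q: "q \<preceq> p" "\<And>n. N \<le> n \<Longrightarrow> q \<tturnstile> le_at (check h) \<tau> n"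
    using stronger_refl unfolding forces_le_star by blast
  show ?thesis
  proof (rule that[OF q(1)])
    show "q \<tturnstile> le_at (check (\<lambda>n. n)) \<tau> n" if "N \<le> n" for n
      by (rule forces_check_le_at_mono[OF q(2)[OF that]]) (simp add: h_def)
    show "can_force_ge \<tau> u n m"
      if n: "N \<le> n" and u: "u \<in> small_stems n" "Cond u (side q) \<preceq> q" for n u m
    proof (rule ccontr)
      assume "\<not> can_force_ge \<tau> u n m"
      define m' where "m' = (LEAST m. \<not> can_force_ge \<tau> u n m)"
      have not_m': "\<not> can_force_ge \<tau> u n m'"
        unfolding m'_def by (rule LeastI) fact
      have "m' \<le> (\<Sum>u\<in>small_stems n. LEAST m. \<not> can_force_ge \<tau> u n m)"
        unfolding m'_def using u(1) by (intro member_le_sum) simp_all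
      then have "m' \<le> h n" by (simp add: h_def)
      then have "Cond u (side q) \<tturnstile> le_at (check (\<lambda>_. m')) \<tau> n"
        using forces_check_le_at_mono[OF forces_mono[OF q(2)[OF n] u(2)], of "\<lambda>_. m'"] by simp
      with not_m' show False unfolding can_force_ge_def by blast
    qed
  qed
qed

lemma dominating_imp_last_min_le_star:
  assumes "p \<tturnstile> dominating \<tau>"
  shows "p \<tturnstile> le_star last_min \<tau>"
  unfolding forces_le_star
proof (intro allI impI)
  fix p' assume "p' \<preceq> p"
  then have "p' \<tturnstile> dominating \<tau>" using assms forces_mono by blast
  then obtain q N where q: "q \<preceq> p'"
    "\<And>n. N \<le> n \<Longrightarrow> q \<tturnstile> le_at (check (\<lambda>n. n)) \<tau> n"
    "\<And>n u m. N \<le> n \<Longrightarrow> u \<in> small_stems n \<Longrightarrow> Cond u (side q) \<preceq> q \<Longrightarrow> can_force_ge \<tau> u n m"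
    using dominating_can_force_ge by blast
  define w where "w u n m = (SOME w. Cond u w \<tturnstile> le_at (check (\<lambda>_. m)) \<tau> n)" for u n m
  have w: "Cond u (w u n m) \<tturnstile> le_at (check (\<lambda>_. m)) \<tau> n" if "can_force_ge \<tau> u n m" for u n m
    using that unfolding can_force_ge_def w_def by (rule someI_ex)
  \<comment> \<open>Summing over all \<open>i'\<close> \<le> \<open>i\<close> makes the single value
    \<open>G j\<close> bound \<open>w u n j\<close> on all of \<open>[k, j]\<close>;
    \<open>Suc i\<close> gives \<open>G n > n\<close>, which will force \<open>k\<close> \<le>
    \<open>n\<close>.\<close>
  define G where "G i = side q i + Suc i +
    (\<Sum>(n, u)\<in>Sigma {..i} small_stems. \<Sum>m\<le>i. \<Sum>i'\<le>i. w u n m i')" for i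
  have G: "w u n m i' \<le> G i" if "n \<le> i" "m \<le> i" "i' \<le> i" "u \<in> small_stems n" for u n m i' i
  proof -
    have "w u n m i' \<le> (\<Sum>i'\<le>i. w u n m i')"
      using that by (intro member_le_sum) simp_all
    also have "\<dots> \<le> (\<Sum>m\<le>i. \<Sum>i'\<le>i. w u n m i')"
      using that by (intro member_le_sum[of m "{..i}" "\<lambda>m. \<Sum>i'\<le>i. w u n m i'"]) simp_all
    also have "\<dots> \<le> (\<Sum>(n, u)\<in>Sigma {..i} small_stems. \<Sum>m\<le>i. \<Sum>i'\<le>i. w u n m i')"
      using that member_le_sum[of "(n, u)" "Sigma {..i} small_stems"
          "\<lambda>(n, u). \<Sum>m\<le>i. \<Sum>i'\<le>i. w u n m i'"] by simp
    finally show ?thesis by (simp add: G_def)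
  qed
  define t where "t = stem q"
  have "Cond t G \<preceq> q" by (simp add: stronger_def t_def G_def)
  \<comment> \<open>From \<open>N'\<close> on, no entry of \<open>t\<close> exceeds
    \<open>n\<close>, so \<open>k\<close> lies past \<open>t\<close>; also \<open>length t\<close>
    \<le> \<open>n\<close>, so the entry at \<open>n\<close>, if present, obeys
    \<open>G\<close>.\<close>
  define N' where "N' = N + length t + sum_list t"
  have "Cond t G \<tturnstile> le_at last_min \<tau> n" if n: "N' \<le> n" for n
    unfolding forces_le_at
  proof (intro allI impI)
    fix c assume "c \<preceq> Cond t G"
    obtain c' j where c': "c' \<preceq> c" "decides c' n j" using decides_dense by blast
    have c'G: "c' \<preceq> Cond t G" using c'(1) \<open>c \<preceq> Cond t G\<close> stronger_trans by blast
    then have c'q: "c' \<preceq> q" using \<open>Cond t G \<preceq> q\<close> stronger_trans by blast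
    define s where "s = stem c'"
    obtain k where "decides_from k c' n j"
      using c'(2) unfolding decides_def by blast
    then have k: "k \<le> j" "j < length s" "n < s ! k" "\<And>i. i < k \<Longrightarrow> s ! i \<le> n"
      "\<And>i. k \<le> i \<Longrightarrow> i \<le> j \<Longrightarrow> s ! j \<le> s ! i"
      by (simp_all add: decides_from_def s_def)
    have sG: "G i \<le> s ! i" if "length t \<le> i" "i < length s" for i
      using side_le_stem_nth[OF c'G] that by (simp add: s_def)
    have st: "s ! i = t ! i" if "i < length t" for i
      using stem_nth(1)[OF c'G] that by (simp add: s_def)
    have "length t \<le> k"
    proof (rule ccontr)
      assume "\<not> length t \<le> k"
      then have "s ! k \<le> sum_list t" using st by (simp add: elem_le_sum_list)
      then show False using k(3) n by (simp add: N'_def)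
    qed
    have "k \<le> n"
    proof (rule ccontr)
      assume "\<not> k \<le> n"
      then have "s ! n \<le> n" "G n \<le> s ! n" using k n sG by (simp_all add: N'_def)
      then show False by (simp add: G_def)
    qed
    have "\<exists>e l. e \<preceq> c' \<and> e \<tturnstile> val \<tau> n l \<and> j \<le> l"
    proof (cases "j < n")
      case True
      have "q \<tturnstile> le_at (check (\<lambda>n. n)) \<tau> n" using q(2) n by (simp add: N'_def)
      then obtain e l where "e \<preceq> c'" "e \<tturnstile> val \<tau> n l" "n \<le> l"
        using c'q unfolding forces_check_le_at by blast
      then show ?thesis using True by (meson less_imp_le le_trans)
    next
      case False
      define u where "u = take k s"
      have u: "u \<in> small_stems n"
        using k \<open>k \<le> n\<close> by (auto simp: small_stems_def u_def in_set_conv_nth)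
      have "prefix t s" using c'G by (simp add: stronger_def s_def)
      then have "prefix t u"
        using \<open>length t \<le> k\<close> by (auto simp: u_def prefix_def)
      then have "Cond u (side q) \<preceq> q"
        using side_le_stem_nth[OF c'q] by (auto simp: stronger_def t_def u_def s_def)
      then have force: "Cond u (w u n j) \<tturnstile> le_at (check (\<lambda>_. j)) \<tau> n"
        using w q(3) u n by (simp add: N'_def)
      \<comment> \<open>Adding the sides gives a common extension of \<open>c'\<close> and
        \<open>Cond u (w u n j)\<close>, provided the entries of \<open>s\<close> from
        \<open>k\<close> on respect \<open>w u n j\<close>.\<close>
      define e where "e = Cond s (\<lambda>i. side c' i + w u n j i)"
      have "e \<preceq> c'" by (simp add: e_def s_def stronger_def)
      have "w u n j i \<le> s ! i" if i: "k \<le> i" "i < length s" for i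
      proof (cases "i \<le> j")
        case True
        \<comment> \<open>Before \<open>j\<close> the entry at \<open>i\<close> may lie inside a
          region where only the minimality of \<open>s ! j\<close> bounds it below, hence the detour
          through \<open>G j\<close>.\<close>
        then have "w u n j i \<le> G j" using False u by (intro G) simp_all
        also have "\<dots> \<le> s ! j" using sG k \<open>length t \<le> k\<close> by simp
        also have "\<dots> \<le> s ! i" using k True i by simp
        finally show ?thesis .
      next
        case beyond: False
        then have "w u n j i \<le> G i" using False u by (intro G) simp_all
        also have "\<dots> \<le> s ! i" using sG i \<open>length t \<le> k\<close> by simp
        finally show ?thesis .
      qed
      then have "e \<preceq> Cond u (w u n j)"
        using k by (auto simp: stronger_def e_def u_def take_is_prefix)
      then obtain e' l where "e' \<preceq> e" "e' \<tturnstile> val \<tau> n l" "j \<le> l"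
        using force unfolding forces_check_le_at by blast
      then show ?thesis using \<open>e \<preceq> c'\<close> stronger_trans by blast
    qed
    then obtain e l where e: "e \<preceq> c'" "e \<tturnstile> val \<tau> n l" "j \<le> l" by blast
    then have "e \<tturnstile> val last_min n j"
      using c'(2) decides_forces_val forces_mono by blast
    then show "\<exists>e k l. e \<preceq> c \<and> e \<tturnstile> val last_min n k \<and> e \<tturnstile> val \<tau> n l \<and> k \<le> l"
      using e c'(1) stronger_trans by blast
  qed
  then show "\<exists>r N. r \<preceq> p' \<and> (\<forall>n\<ge>N. r \<tturnstile> le_at last_min \<tau> n)"
    using \<open>Cond t G \<preceq> q\<close> q(1) stronger_trans by blast
qed

theorem theorem2:
  "true_in_extension
     (Ex_name (\<lambda>x. Conj (is_real x) (Conj (unbounded x)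
        (All_name (\<lambda>y. Imp (Conj (is_real y) (dominating y)) (le_star x y))))))"
proof -
  have "p \<tturnstile> Conj (is_real last_min) (Conj (unbounded last_min)
      (All_name (\<lambda>y. Imp (Conj (is_real y) (dominating y)) (le_star last_min y))))" for p
    using forces_is_real_last_min forces_unbounded_last_min dominating_imp_last_min_le_star
    unfolding forces.simps forces_Imp by blast
  then show ?thesis
    unfolding true_in_extension_def forces_Ex using stronger_refl by blast
qed

end
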